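(* Let $\mathcal{K}$ be a class of compact groups closed under taking closed subgroups and finite direct products. Let $X$ be a closed subgroup of a direct product (with the product topology) of groups from $\mathcal{K}$. Then any quotient of $X$ (by any normal subgroup, not necessarily topologically closed) is $\mathcal{K}$-approximable. In particular, this holds when $\mathcal{K}$ is the class of finite nilpotent groups, of finite solvable groups, of all finite groups, or of all compact groups.
   Context: Finite groups carry the discrete topology; compact groups are compact Hausdorff topological groups; direct products are unrestricted. For a group $H$, $X\subseteq H$ and $n\in\mathbb{N}$, put $C_n(X,H)=\{x_1^{g_1}\cdots x_n^{g_n} : x_i\in X\text{ or }x_i^{-1}\in X,\ g_i\in H\}$, where $x^g=g^{-1}xg$. A set $Y\subseteq H$ is $n$-separated from $X$ in $H$ if $Y\cap C_n(X,H)=\emptyset$. A group $G$ is $\mathcal{K}$-approximable if for every finite $\Phi\subset G$ and every $n\in\mathbb{N}$ there exist $H\in\mathcal{K}$ and a map $\phi:\Phi\to H$ (with no topological requirement) such that $\phi(1)=1$ (when $1\in\Phi$) and $\phi(\Phi\setminus\{1\})$ is $n$-separated in $H$ from $\{\phi(g)\phi(h)(\phi(gh))^{-1} : g,h,gh\in\Phi\}$. *)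

theory Defs
  imports "HOL-Analysis.Analysis" "HOL-Algebra.Product_Groups" "HOL-Algebra.Solvable_Groups"
begin

record 'a top_group = "'a monoid" +
  topol :: "'a topology"

locale topological_group = group G for G :: "'a top_group" (structure) +
  assumes topspace_topol: "topspace (topol G) = carrier G"
    and continuous_mult:
      "continuous_map (prod_topology (topol G) (topol G)) (topol G) (\<lambda>(x, y). x \<otimes> y)"
    and continuous_inv: "continuous_map (topol G) (topol G) (\<lambda>x. inv x)"

definition compact_groups :: "'a top_group set" where
  "compact_groups =
     {G. topological_group G \<and> compact_space (topol G) \<and> Hausdorff_space (topol G)}"

definition finite_groups :: "'a top_group set" where
  "finite_groups = {G. group G \<and> finite (carrier G) \<and> topol G = discrete_topology (carrier G)}"

lemma finite_groups_subset_compact_groups: "finite_groups \<subseteq> compact_groups"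
proof
  fix G :: "'a top_group"
  assume "G \<in> finite_groups"
  then interpret group G + G: group G
    by (simp_all add: finite_groups_def)
  have fin: "finite (carrier G)" and T: "topol G = discrete_topology (carrier G)"
    using \<open>G \<in> finite_groups\<close> by (simp_all add: finite_groups_def)
  have "topological_group G"
    by unfold_locales (auto simp: T continuous_map simp flip: prod_topology_discrete_topology)
  then show "G \<in> compact_groups"
    by (simp add: compact_groups_def T fin compact_space_discrete_topology
        Hausdorff_space_discrete_topology)
qed

definition finite_solvable_groups :: "'a top_group set" where
  "finite_solvable_groups = {G \<in> finite_groups. solvable G}"

primrec lower_central :: "('a, 'b) monoid_scheme \<Rightarrow> nat \<Rightarrow> 'a set" where
  "lower_central G 0 = carrier G"
| "lower_central G (Suc n) = generate G
     {x \<otimes>\<^bsub>G\<^esub> y \<otimes>\<^bsub>G\<^esub> inv\<^bsub>G\<^esub> x \<otimes>\<^bsub>G\<^esub> inv\<^bsub>G\<^esub> y | x y. x \<in> lower_central G n \<and> y \<in> carrier G}"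

definition nilpotent :: "('a, 'b) monoid_scheme \<Rightarrow> bool" where
  "nilpotent G \<longleftrightarrow> (\<exists>n. lower_central G n = {\<one>\<^bsub>G\<^esub>})"

definition finite_nilpotent_groups :: "'a top_group set" where
  "finite_nilpotent_groups = {G \<in> finite_groups. nilpotent G}"

definition closed_subgroup :: "'a set \<Rightarrow> 'a top_group \<Rightarrow> bool" where
  "closed_subgroup S G \<longleftrightarrow> subgroup S G \<and> closedin (topol G) S"

definition top_subgroup :: "'a top_group \<Rightarrow> 'a set \<Rightarrow> 'a top_group" where
  "top_subgroup G S = G\<lparr>carrier := S, topol := subtopology (topol G) S\<rparr>"

definition top_product :: "'i set \<Rightarrow> ('i \<Rightarrow> 'a top_group) \<Rightarrow> ('i \<Rightarrow> 'a) top_group" where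
  "top_product I G =
     \<lparr>carrier = carrier (product_group I G),
      monoid.mult = monoid.mult (product_group I G),
      one = one (product_group I G),
      topol = product_topology (\<lambda>i. topol (G i)) I\<rparr>"

definition top_isomorphic :: "'a top_group \<Rightarrow> 'b top_group \<Rightarrow> bool" where
  "top_isomorphic G H \<longleftrightarrow> (\<exists>h \<in> iso G H. homeomorphic_map (topol G) (topol H) h)"

text \<open>
  A class of groups is a set of groups whose carriers lie in one fixed type, and a product of
  groups in a type is not literally a group in that type. Closure is therefore closure up to
  isomorphism of topological groups. The index type \<open>nat\<close> below covers all finite families,
  and \<open>n = 0\<close> is the empty product, i.e. the trivial group.

  Every finite group has a copy with carrier in \<open>nat\<close>, and \<open>'a + nat\<close> is an infinite type
  holding a copy of every group with carrier in \<open>'a\<close>. So the finite groups over \<open>nat\<close> and the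
  compact groups over \<open>'a + nat\<close> are closed under finite products, also when \<open>'a\<close> is finite.
\<close>

definition closed_under_closed_subgroups :: "'a top_group set \<Rightarrow> bool" where
  "closed_under_closed_subgroups K \<longleftrightarrow>
     (\<forall>G \<in> K. \<forall>S. closed_subgroup S G \<longrightarrow> (\<exists>H \<in> K. top_isomorphic (top_subgroup G S) H))"

definition closed_under_finite_products :: "'a top_group set \<Rightarrow> bool" where
  "closed_under_finite_products K \<longleftrightarrow>
     (\<forall>(n::nat) F. (\<forall>i<n. F i \<in> K) \<longrightarrow> (\<exists>H \<in> K. top_isomorphic (top_product {..<n} F) H))"

text \<open>
  In \<open>conj_products n X H\<close>, which is $C_n(X,H)$, a list entry \<open>(x, g)\<close> stands for the
  factor \<open>x\<^sup>g\<close>.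
\<close>

definition conj_products :: "nat \<Rightarrow> 'a set \<Rightarrow> ('a, 'b) monoid_scheme \<Rightarrow> 'a set" where
  "conj_products n X H =
     {foldr (\<otimes>\<^bsub>H\<^esub>) (map (\<lambda>(x, g). inv\<^bsub>H\<^esub> g \<otimes>\<^bsub>H\<^esub> x \<otimes>\<^bsub>H\<^esub> g) xs) \<one>\<^bsub>H\<^esub> | xs.
        length xs = n \<and>
        (\<forall>(x, g) \<in> set xs. x \<in> carrier H \<and> g \<in> carrier H \<and> (x \<in> X \<or> inv\<^bsub>H\<^esub> x \<in> X))}"

definition separated :: "nat \<Rightarrow> 'a set \<Rightarrow> 'a set \<Rightarrow> ('a, 'b) monoid_scheme \<Rightarrow> bool" where
  "separated n Y X H \<longleftrightarrow> Y \<inter> conj_products n X H = {}"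

definition approximable ::
    "('h, 'c) monoid_scheme set \<Rightarrow> ('a, 'b) monoid_scheme \<Rightarrow> bool" where
  "approximable K G \<longleftrightarrow>
     (\<forall>\<Phi> n. finite \<Phi> \<and> \<Phi> \<subseteq> carrier G \<longrightarrow>
        (\<exists>H \<in> K. \<exists>\<phi> \<in> \<Phi> \<rightarrow> carrier H.
           (\<one>\<^bsub>G\<^esub> \<in> \<Phi> \<longrightarrow> \<phi> \<one>\<^bsub>G\<^esub> = \<one>\<^bsub>H\<^esub>) \<and>
           separated n (\<phi> ` (\<Phi> - {\<one>\<^bsub>G\<^esub>}))
             {\<phi> g \<otimes>\<^bsub>H\<^esub> \<phi> h \<otimes>\<^bsub>H\<^esub> inv\<^bsub>H\<^esub> (\<phi> (g \<otimes>\<^bsub>G\<^esub> h)) | g h. g \<in> \<Phi> \<and> h \<in> \<Phi> \<and> g \<otimes>\<^bsub>G\<^esub> h \<in> \<Phi>} H))"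

end

theory Submission
  imports Defs
begin

text \<open>
  Lift a finite subset \<open>\<Phi>\<close> of \<open>X/N\<close> to representatives \<open>r g\<close> in \<open>X\<close>. The multiplicative defects of \<open>r\<close> form
  a finite set \<open>E \<subseteq> N\<close>. Although \<open>N\<close> need not be closed, \<open>C\<^sub>n(E, X)\<close> is compact, being a continuous image
  of finitely many copies of a power of \<open>X\<close>; it lies in \<open>N\<close> and hence misses every \<open>r g\<close> with \<open>g \<noteq> 1\<close>.
  In the product topology finitely many coordinates witness this. The image of \<open>X\<close> in the product over
  these coordinates is a closed subgroup, so it is a copy of a group of the class, and surjective
  homomorphisms map \<open>C\<^sub>n(E, X)\<close> onto the corresponding set of the image.
\<close>

section \<open>Products, subgroups and copies of compact groups\<close>

text \<open>The group axioms involve only carrier, unit and multiplication. This carries facts about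
  \<open>product_group\<close> and about subgroup records over to records with a topology, although
  the record types differ.\<close>

lemma group_cong:
  assumes "group G" "carrier H = carrier G" "\<one>\<^bsub>H\<^esub> = \<one>\<^bsub>G\<^esub>" "mult H = mult G"
  shows "group H"
  using assms(1) unfolding Group.group_def Group.monoid_def Group.group_axioms_def Units_def assms(2-4) .

lemma m_inv_cong:
  assumes "carrier H = carrier G" "\<one>\<^bsub>H\<^esub> = \<one>\<^bsub>G\<^esub>" "mult H = mult G"
  shows "inv\<^bsub>H\<^esub> x = inv\<^bsub>G\<^esub> x"
  using assms by (simp add: m_inv_def)

lemma top_product_simps [simp]:
  "carrier (top_product I G) = (\<Pi>\<^sub>E i\<in>I. carrier (G i))"
  "\<one>\<^bsub>top_product I G\<^esub> = (\<lambda>i\<in>I. \<one>\<^bsub>G i\<^esub>)"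
  "x \<otimes>\<^bsub>top_product I G\<^esub> y = (\<lambda>i\<in>I. x i \<otimes>\<^bsub>G i\<^esub> y i)"
  "topol (top_product I G) = product_topology (\<lambda>i. topol (G i)) I"
  by (simp_all add: top_product_def)

lemma top_subgroup_simps [simp]:
  "carrier (top_subgroup G S) = S"
  "\<one>\<^bsub>top_subgroup G S\<^esub> = \<one>\<^bsub>G\<^esub>"
  "mult (top_subgroup G S) = mult G"
  "topol (top_subgroup G S) = subtopology (topol G) S"
  by (simp_all add: top_subgroup_def)

lemma group_top_product:
  assumes "\<And>i. i \<in> I \<Longrightarrow> group (G i)"
  shows "group (top_product I G)"
  by (rule group_cong[OF product_group[OF assms]]) (simp_all add: top_product_def)

lemma inv_top_product:
  assumes "\<And>i. i \<in> I \<Longrightarrow> group (G i)" "x \<in> (\<Pi>\<^sub>E i\<in>I. carrier (G i))"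
  shows "inv\<^bsub>top_product I G\<^esub> x = (\<lambda>i\<in>I. inv\<^bsub>G i\<^esub> x i)"
proof -
  have "inv\<^bsub>top_product I G\<^esub> x = inv\<^bsub>product_group I G\<^esub> x"
    by (rule m_inv_cong) (simp_all add: top_product_def)
  then show ?thesis
    using assms by simp
qed

lemma group_top_subgroup:
  assumes "group G" "subgroup S G"
  shows "group (top_subgroup G S)"
  by (rule group_cong[OF group.subgroup_imp_group[OF assms]]) simp_all

lemma inv_top_subgroup:
  assumes "group G" "subgroup S G" "x \<in> S"
  shows "inv\<^bsub>top_subgroup G S\<^esub> x = inv\<^bsub>G\<^esub> x"
proof -
  have "inv\<^bsub>top_subgroup G S\<^esub> x = inv\<^bsub>G\<lparr>carrier := S\<rparr>\<^esub> x"
    by (rule m_inv_cong) simp_all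
  then show ?thesis
    using group.m_inv_consistent[OF assms] by simp
qed

lemma closed_subgroup_subset: "closed_subgroup S G \<Longrightarrow> S \<subseteq> carrier G"
  by (simp add: closed_subgroup_def subgroup.subset)

lemma compact_groups_imp_group: "G \<in> compact_groups \<Longrightarrow> group G"
  by (simp add: compact_groups_def topological_group_def)

lemma compact_groups_topspace: "G \<in> compact_groups \<Longrightarrow> topspace (topol G) = carrier G"
  by (simp add: compact_groups_def topological_group_def topological_group_axioms_def)

text \<open>Compactness is Tychonoff's theorem; continuity of the operations is checked coordinate
  by coordinate.\<close>

lemma top_product_compact_groups:
  assumes "\<And>i. i \<in> I \<Longrightarrow> G i \<in> compact_groups"
  shows "top_product I G \<in> compact_groups"
proof -
  let ?P = "top_product I G"
  let ?T = "product_topology (\<lambda>i. topol (G i)) I"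
  have grp: "group (G i)" and top: "topspace (topol (G i)) = carrier (G i)"
    and mult: "continuous_map (prod_topology (topol (G i)) (topol (G i))) (topol (G i))
                 (\<lambda>(x, y). x \<otimes>\<^bsub>G i\<^esub> y)"
    and inv: "continuous_map (topol (G i)) (topol (G i)) (\<lambda>x. inv\<^bsub>G i\<^esub> x)"
    and cpt: "compact_space (topol (G i))" and hd: "Hausdorff_space (topol (G i))"
    if "i \<in> I" for i
    using assms[OF that]
    by (auto simp: compact_groups_def topological_group_def topological_group_axioms_def)
  have topP: "topspace ?T = (\<Pi>\<^sub>E i\<in>I. carrier (G i))"
    by (auto simp: top cong: PiE_cong)
  have proj: "continuous_map ?T (topol (G i)) (\<lambda>x. x i)" if "i \<in> I" for i
    using that by (rule continuous_map_product_projection)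
  have "continuous_map (prod_topology ?T ?T) ?T (\<lambda>(x, y). \<lambda>i\<in>I. x i \<otimes>\<^bsub>G i\<^esub> y i)"
    unfolding continuous_map_componentwise
  proof (intro conjI ballI)
    fix i assume i: "i \<in> I"
    have "continuous_map (prod_topology ?T ?T) (prod_topology (topol (G i)) (topol (G i)))
            (\<lambda>z. (fst z i, snd z i))"
      using continuous_map_compose[OF continuous_map_fst proj[OF i], of ?T]
        continuous_map_compose[OF continuous_map_snd proj[OF i], of ?T]
      by (simp add: continuous_map_pairwise o_def)
    from continuous_map_compose[OF this mult[OF i]]
    show "continuous_map (prod_topology ?T ?T) (topol (G i))
            (\<lambda>z. (case z of (x, y) \<Rightarrow> \<lambda>i\<in>I. x i \<otimes>\<^bsub>G i\<^esub> y i) i)"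
      by (rule continuous_map_eq) (auto simp: i)
  qed auto
  \<comment> \<open>The coordinatewise formula for the inverse holds on the carrier only. The
    carrier is the topspace, so continuity transfers along equality there.\<close>
  moreover have "continuous_map ?T ?T (\<lambda>x. inv\<^bsub>?P\<^esub> x)"
    unfolding continuous_map_componentwise
  proof (intro conjI ballI)
    fix i assume i: "i \<in> I"
    from continuous_map_compose[OF proj[OF i] inv[OF i]]
    show "continuous_map ?T (topol (G i)) (\<lambda>x. (inv\<^bsub>?P\<^esub> x) i)"
      by (rule continuous_map_eq) (auto simp: i inv_top_product[OF grp] topP simp del: topspace_product_topology)
  qed (auto simp: inv_top_product[OF grp] topP simp del: topspace_product_topology)
  ultimately have "topological_group ?P"
    using group_top_product[OF grp] topP
    by (simp add: topological_group_def topological_group_axioms_def case_prod_unfold)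
  then show ?thesis
    using cpt hd by (auto simp: compact_groups_def compact_space_product_topology
        Hausdorff_space_product_topology)
qed

text \<open>Closedness of \<open>S\<close> gives compactness; continuity of the operations and the
  Hausdorff property restrict to the subspace.\<close>

lemma top_subgroup_compact_groups:
  assumes G: "G \<in> compact_groups" and S: "closed_subgroup S G"
  shows "top_subgroup G S \<in> compact_groups"
proof -
  have grp: "group G" and top: "topspace (topol G) = carrier G"
    and mult: "continuous_map (prod_topology (topol G) (topol G)) (topol G) (\<lambda>(x, y). x \<otimes>\<^bsub>G\<^esub> y)"
    and inv: "continuous_map (topol G) (topol G) (\<lambda>x. inv\<^bsub>G\<^esub> x)"
    and cpt: "compact_space (topol G)" and hd: "Hausdorff_space (topol G)"
    using G by (auto simp: compact_groups_def topological_group_def topological_group_axioms_def)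
  have sub: "subgroup S G" and cl: "closedin (topol G) S"
    using S by (auto simp: closed_subgroup_def)
  have SG: "S \<subseteq> carrier G"
    using sub by (rule subgroup.subset)
  let ?T = "subtopology (topol G) S"
  have topS: "topspace ?T = S"
    using SG top by auto
  have "continuous_map (prod_topology ?T ?T) ?T (\<lambda>(x, y). x \<otimes>\<^bsub>G\<^esub> y)"
    unfolding continuous_map_in_subtopology prod_topology_subtopology(1) subtopology_subtopology
    using mult subgroup.m_closed[OF sub]
    by (auto simp: continuous_map_from_subtopology prod_topology_subtopology)
  moreover have "continuous_map ?T ?T (\<lambda>x. inv\<^bsub>G\<^esub> x)"
    using inv subgroup.m_inv_closed[OF sub]
    by (auto simp: continuous_map_in_subtopology continuous_map_from_subtopology)
  then have "continuous_map ?T ?T (\<lambda>x. inv\<^bsub>top_subgroup G S\<^esub> x)"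
    by (rule continuous_map_eq) (use inv_top_subgroup[OF grp sub] in auto)
  ultimately have "topological_group (top_subgroup G S)"
    using group_top_subgroup[OF grp sub] topS
    by (simp add: topological_group_def topological_group_axioms_def)
  moreover have "compact_space ?T"
    using closedin_compact_space[OF cpt cl] by (rule compact_space_subtopology)
  ultimately show ?thesis
    using hd by (simp add: compact_groups_def Hausdorff_space_subtopology)
qed

text \<open>Transport of structure along an \<open>f\<close> injective on the carrier; pulling the
  topology back along the inverse makes \<open>f\<close> a homeomorphism. It brings groups of
  functions, such as subgroups of products, into the single type over which a class is
  formed.\<close>

definition copy_group :: "('a \<Rightarrow> 'b) \<Rightarrow> 'a top_group \<Rightarrow> 'b top_group" where
  "copy_group f G =
     \<lparr>carrier = f ` carrier G,
      monoid.mult = (\<lambda>x y. f (inv_into (carrier G) f x \<otimes>\<^bsub>G\<^esub> inv_into (carrier G) f y)),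
      one = f \<one>\<^bsub>G\<^esub>,
      topol = pullback_topology (f ` carrier G) (inv_into (carrier G) f) (topol G)\<rparr>"

lemma copy_group_iso:
  assumes "group G" "inj_on f (carrier G)"
  shows "f \<in> iso G (copy_group f G)" "group (copy_group f G)"
proof -
  interpret group G by fact
  have "f \<in> hom G (copy_group f G)"
    using assms(2) by (auto simp: hom_def copy_group_def)
  then show "f \<in> iso G (copy_group f G)"
    using assms(2) by (simp add: iso_def bij_betw_def copy_group_def)
  then have "G \<cong> copy_group f G"
    by (auto simp: is_iso_def)
  moreover have "monoid (copy_group f G)"
    using assms(2) by unfold_locales (auto simp: copy_group_def m_assoc)
  ultimately show "group (copy_group f G)"
    by (rule iso_imp_group)
qed

lemma copy_group_compact_groups:
  assumes G: "G \<in> compact_groups" and f: "inj_on f (carrier G)"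
  shows "copy_group f G \<in> compact_groups"
proof -
  have grp: "group G" and top: "topspace (topol G) = carrier G"
    and mult: "continuous_map (prod_topology (topol G) (topol G)) (topol G) (\<lambda>(x, y). x \<otimes>\<^bsub>G\<^esub> y)"
    and inv: "continuous_map (topol G) (topol G) (\<lambda>x. inv\<^bsub>G\<^esub> x)"
    and cpt: "compact_space (topol G)" and hd: "Hausdorff_space (topol G)"
    using G by (auto simp: compact_groups_def topological_group_def topological_group_axioms_def)
  interpret group G by (rule grp)
  let ?H = "copy_group f G" and ?g = "inv_into (carrier G) f"
  let ?T = "topol ?H"
  have H: "group ?H" and iso: "f \<in> iso G ?H"
    using copy_group_iso[OF grp f] by auto
  have T: "?T = pullback_topology (f ` carrier G) ?g (topol G)"
    and cH: "carrier ?H = f ` carrier G"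
    and mH: "\<And>x y. x \<otimes>\<^bsub>?H\<^esub> y = f (?g x \<otimes>\<^bsub>G\<^esub> ?g y)"
    by (simp_all add: copy_group_def)
  have topH: "topspace ?T = f ` carrier G"
    using f by (auto simp: T topspace_pullback_topology top)
  have cg: "continuous_map ?T (topol G) ?g"
    using continuous_map_pullback[OF continuous_map_id, of "f ` carrier G" ?g "topol G"]
    by (simp add: T id_def comp_def)
  have cf: "continuous_map (topol G) ?T f"
    unfolding T
  proof (rule continuous_map_pullback')
    show "continuous_map (topol G) (topol G) (?g \<circ> f)"
      by (rule continuous_map_eq[OF continuous_map_id]) (use f top in auto)
  qed (use top in auto)
  have homeo: "homeomorphic_maps (topol G) ?T f ?g"
    using cf cg f by (auto simp: homeomorphic_maps_def topH top)
  \<comment> \<open>Multiplication of the copy is \<open>f\<close> after multiplication of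
    \<open>G\<close> after \<open>?g\<close> in both arguments, a composite of continuous
    maps.\<close>
  have "continuous_map (prod_topology ?T ?T) (prod_topology (topol G) (topol G))
          (\<lambda>z. (?g (fst z), ?g (snd z)))"
    using continuous_map_compose[OF continuous_map_fst cg, of ?T]
      continuous_map_compose[OF continuous_map_snd cg, of ?T]
    by (simp add: continuous_map_pairwise o_def)
  from continuous_map_compose[OF continuous_map_compose[OF this mult] cf]
  have "continuous_map (prod_topology ?T ?T) ?T (\<lambda>(x, y). x \<otimes>\<^bsub>?H\<^esub> y)"
    by (rule continuous_map_eq) (auto simp: mH)
  moreover from continuous_map_compose[OF continuous_map_compose[OF cg inv] cf]
  have "continuous_map ?T ?T (\<lambda>x. inv\<^bsub>?H\<^esub> x)"
  proof (rule continuous_map_eq)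
    fix x assume "x \<in> topspace ?T"
    then obtain y where y: "y \<in> carrier G" "x = f y"
      by (auto simp: topH)
    interpret h: group_hom G ?H f
      using iso H by (auto simp: group_hom_def group_hom_axioms_def iso_def grp)
    show "(f \<circ> ((\<lambda>x. inv\<^bsub>G\<^esub> x) \<circ> ?g)) x = inv\<^bsub>?H\<^esub> x"
      using y f by simp
  qed
  ultimately have "topological_group ?H"
    using H topH by (simp add: topological_group_def topological_group_axioms_def cH)
  moreover have "topol G homeomorphic_space ?T"
    using homeo by (auto simp: homeomorphic_space_def)
  then have "compact_space ?T" "Hausdorff_space ?T"
    using cpt hd homeomorphic_compact_space homeomorphic_Hausdorff_space by blast+
  ultimately show ?thesis
    by (simp add: compact_groups_def)
qed

text \<open>A finite T1 space is discrete, so a compact group on a finite carrier already has the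
  topology that \<open>finite_groups\<close> demands.\<close>

lemma finite_compact_group:
  assumes "G \<in> compact_groups" "finite (carrier G)"
  shows "G \<in> finite_groups"
proof -
  have "topol G = discrete_topology (carrier G)"
    using assms compact_groups_topspace[OF assms(1)]
    by (metis (no_types, lifting) Hausdorff_imp_t1_space compact_groups_def
        finite_t1_space_imp_discrete_topology mem_Collect_eq)
  then show ?thesis
    using assms compact_groups_imp_group by (auto simp: finite_groups_def)
qed

section \<open>Products of conjugates\<close>

lemma conj_products_0: "conj_products 0 X H = {\<one>\<^bsub>H\<^esub>}"
  by (auto simp: conj_products_def)

text \<open>Splitting off the leftmost factor replaces lists by a recursion, on which all later
  inductions over \<open>n\<close> run.\<close>

lemma conj_products_Suc:
  "conj_products (Suc n) X H =
     {inv\<^bsub>H\<^esub> g \<otimes>\<^bsub>H\<^esub> x \<otimes>\<^bsub>H\<^esub> g \<otimes>\<^bsub>H\<^esub> y | x g y.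
        x \<in> carrier H \<and> g \<in> carrier H \<and> (x \<in> X \<or> inv\<^bsub>H\<^esub> x \<in> X) \<and> y \<in> conj_products n X H}"
  (is "?L = ?R")
proof
  show "?L \<subseteq> ?R"
    unfolding conj_products_def by (force simp: length_Suc_conv)
  show "?R \<subseteq> ?L"
  proof
    fix z assume "z \<in> ?R"
    then obtain x g y where *: "x \<in> carrier H" "g \<in> carrier H" "x \<in> X \<or> inv\<^bsub>H\<^esub> x \<in> X"
      and y: "y \<in> conj_products n X H" and z: "z = inv\<^bsub>H\<^esub> g \<otimes>\<^bsub>H\<^esub> x \<otimes>\<^bsub>H\<^esub> g \<otimes>\<^bsub>H\<^esub> y"
      by blast
    from y obtain xs where
      "y = foldr (\<otimes>\<^bsub>H\<^esub>) (map (\<lambda>(x, g). inv\<^bsub>H\<^esub> g \<otimes>\<^bsub>H\<^esub> x \<otimes>\<^bsub>H\<^esub> g) xs) \<one>\<^bsub>H\<^esub>" "length xs = n"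
      "\<forall>(x, g) \<in> set xs. x \<in> carrier H \<and> g \<in> carrier H \<and> (x \<in> X \<or> inv\<^bsub>H\<^esub> x \<in> X)"
      unfolding conj_products_def by blast
    then show "z \<in> ?L"
      unfolding conj_products_def using * z by (intro CollectI exI[of _ "(x, g) # xs"]) simp
  qed
qed

lemma (in group) conj_products_subset_normal:
  assumes "N \<lhd> G" "E \<subseteq> N"
  shows "conj_products n E G \<subseteq> N"
proof (induction n)
  interpret N: normal N G by fact
  case (Suc n)
  \<comment> \<open>If only \<open>inv x\<close> lies in \<open>E\<close>, then \<open>x\<close> is
    the inverse of an element of \<open>N\<close>.\<close>
  have "x \<in> N" if "x \<in> carrier G" "x \<in> E \<or> inv x \<in> E" for x
    using that assms(2) N.m_inv_closed[of "inv x"] by auto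
  then have "inv g \<otimes> x \<otimes> g \<otimes> y \<in> N"
    if "x \<in> carrier G" "g \<in> carrier G" "x \<in> E \<or> inv x \<in> E" "y \<in> conj_products n E G" for x g y
    using that Suc by (intro N.m_closed N.inv_op_closed1) auto
  then show ?case
    unfolding conj_products_Suc by blast
qed (use assms(1) normal_imp_subgroup subgroup.one_closed in \<open>auto simp: conj_products_0\<close>)

text \<open>Factors are lifted one at a time. Surjectivity is what lifts the conjugating elements,
  which range over all of \<open>H\<close>.\<close>

lemma (in group_hom) conj_products_image:
  assumes surj: "h ` carrier G = carrier H" and E: "E \<subseteq> carrier G"
  shows "conj_products n (h ` E) H \<subseteq> h ` conj_products n E G"
proof (induction n)
  case (Suc n)
  show ?case
  proof
    fix z assume "z \<in> conj_products (Suc n) (h ` E) H"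
    then obtain x g y where x: "x \<in> carrier H" "x \<in> h ` E \<or> inv\<^bsub>H\<^esub> x \<in> h ` E"
      and g: "g \<in> carrier H" and y: "y \<in> conj_products n (h ` E) H"
      and z: "z = inv\<^bsub>H\<^esub> g \<otimes>\<^bsub>H\<^esub> x \<otimes>\<^bsub>H\<^esub> g \<otimes>\<^bsub>H\<^esub> y"
      unfolding conj_products_Suc by blast
    obtain g' where g': "g' \<in> carrier G" "g = h g'"
      using g surj by blast
    obtain y' where y': "y' \<in> conj_products n E G" "y = h y'"
      using y Suc by blast
    have y'G: "y' \<in> carrier G"
    proof -
      \<comment> \<open>The whole group is a normal subgroup containing \<open>E\<close>, so
        \<open>conj_products_subset_normal\<close> places \<open>y'\<close> in the carrier.\<close>
      have "carrier G \<lhd> G"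
        using G.normal_invI[OF G.subgroup_self] by auto
      then show ?thesis
        using G.conj_products_subset_normal[OF _ E] y' by blast
    qed
    \<comment> \<open>An arbitrary preimage of \<open>x\<close> would not do, since
      \<open>x'\<close> or its inverse must lie in \<open>E\<close>. When \<open>inv x\<close> is
      the image of some \<open>e\<close> in \<open>E\<close>, the lift is
      \<open>inv e\<close>.\<close>
    obtain x' where x': "x' \<in> carrier G" "x' \<in> E \<or> inv x' \<in> E" "x = h x'"
    proof (cases "x \<in> h ` E")
      case False
      then obtain e where e: "e \<in> E" "inv\<^bsub>H\<^esub> x = h e"
        using x by blast
      then have "x = h (inv e)"
        using E x(1) by (metis H.inv_inv hom_inv subsetD)
      with e that[of "inv e"] E show thesis
        by auto
    qed (use that E in auto)
    have "z = h (inv g' \<otimes> x' \<otimes> g' \<otimes> y')"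
      using z g' x' y' y'G by simp
    then show "z \<in> h ` conj_products (Suc n) E G"
      unfolding conj_products_Suc using g'(1) x'(1,2) y'(1) by blast
  qed
qed (auto simp: conj_products_0)

text \<open>Each conjugacy class is a continuous image of the compact group. Finitely many of them
  form a compact set, and one more factor multiplies two compact sets.\<close>

lemma compactin_conj_products:
  assumes G: "G \<in> compact_groups" and E: "finite E" "E \<subseteq> carrier G"
  shows "compactin (topol G) (conj_products n E G)"
proof (induction n)
  have grp: "group G" and top: "topspace (topol G) = carrier G"
    and mult: "continuous_map (prod_topology (topol G) (topol G)) (topol G) (\<lambda>(x, y). x \<otimes>\<^bsub>G\<^esub> y)"
    and inv: "continuous_map (topol G) (topol G) (\<lambda>x. inv\<^bsub>G\<^esub> x)"
    and cpt: "compact_space (topol G)"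
    using G by (auto simp: compact_groups_def topological_group_def topological_group_axioms_def)
  interpret group G by (rule grp)
  {
    case 0
    then show ?case
      by (simp add: conj_products_0 top)
  next
    case (Suc n)
    let ?S = "{x \<in> carrier G. x \<in> E \<or> inv\<^bsub>G\<^esub> x \<in> E}"
    let ?m = "\<lambda>(x, y). x \<otimes>\<^bsub>G\<^esub> y" and ?c = "\<lambda>x g. inv\<^bsub>G\<^esub> g \<otimes>\<^bsub>G\<^esub> x \<otimes>\<^bsub>G\<^esub> g"
    \<comment> \<open>The admissible base elements are those of \<open>E\<close> and their inverses,
      so the union over them below is finite.\<close>
    have "?S \<subseteq> E \<union> m_inv G ` E"
      by (force intro: image_eqI[where x = "inv\<^bsub>G\<^esub> _"])
    then have fin: "finite ?S"
      using E(1) by (meson finite_UnI finite_imageI finite_subset)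
    have prod: "continuous_map (topol G) (topol G) (\<lambda>g. a g \<otimes>\<^bsub>G\<^esub> b g)"
      if "continuous_map (topol G) (topol G) a" "continuous_map (topol G) (topol G) b" for a b
      using continuous_map_compose[OF _ mult, of "topol G" "\<lambda>g. (a g, b g)"] that
      by (simp add: continuous_map_pairwise o_def)
    have "continuous_map (topol G) (topol G) (?c x)" if "x \<in> ?S" for x
      using that by (intro prod inv) (auto simp: top)
    then have "compactin (topol G) (?c x ` carrier G)" if "x \<in> ?S" for x
      using that cpt by (metis (no_types, lifting) compact_space_def image_compactin top)
    then have "compactin (topol G) (\<Union>x\<in>?S. ?c x ` carrier G)"
      using fin by (intro compactin_Union) auto
    then have "compactin (topol G)
        (?m ` ((\<Union>x\<in>?S. ?c x ` carrier G) \<times> conj_products n E G))"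
      using Suc by (intro image_compactin[OF _ mult]) (simp add: compactin_Times)
    moreover have "?m ` ((\<Union>x\<in>?S. ?c x ` carrier G) \<times> conj_products n E G) =
        conj_products (Suc n) E G"
      unfolding conj_products_Suc by (auto simp: image_iff)
    ultimately show ?case
      by simp
  }
qed

section \<open>Projection to finitely many coordinates\<close>

text \<open>The complement of \<open>C\<close> contains a basic open box around \<open>x\<close>.
  The finitely many coordinates in which the box is restricted work for all points of
  \<open>C\<close> at once.\<close>

lemma separating_coordinates:
  assumes "closedin (product_topology T I) C" "x \<in> topspace (product_topology T I)" "x \<notin> C"
  obtains J where "finite J" "J \<subseteq> I" "\<And>c. c \<in> C \<Longrightarrow> \<exists>j\<in>J. c j \<noteq> x j"
proof -
  have "openin (product_topology T I) (topspace (product_topology T I) - C)"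
    using assms(1) by blast
  then obtain U where U: "finite {i \<in> I. U i \<noteq> topspace (T i)}"
    "x \<in> Pi\<^sub>E I U" "Pi\<^sub>E I U \<subseteq> topspace (product_topology T I) - C"
    using assms(2,3) unfolding openin_product_topology_alt by blast
  show thesis
  proof (rule that[OF U(1)])
    fix c assume c: "c \<in> C"
    then have "c \<in> (\<Pi>\<^sub>E i\<in>I. topspace (T i))" "c \<notin> Pi\<^sub>E I U"
      using closedin_subset[OF assms(1)] U(3) by auto
    then show "\<exists>j\<in>{i \<in> I. U i \<noteq> topspace (T i)}. c j \<noteq> x j"
      using U(2) by (auto simp: PiE_iff)
  qed blast
qed

text \<open>The projection to finitely many coordinates, reindexed by an initial segment of the
  naturals to match the index type in \<open>closed_under_finite_products\<close>.\<close>

definition coordinates :: "nat \<Rightarrow> (nat \<Rightarrow> 'i) \<Rightarrow> ('i \<Rightarrow> 'a) \<Rightarrow> nat \<Rightarrow> 'a" where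
  "coordinates m e x = (\<lambda>k\<in>{..<m}. x (e k))"

lemma coordinates_hom:
  assumes "\<And>k. k < m \<Longrightarrow> e k \<in> I"
  shows "coordinates m e \<in> hom (top_product I G) (top_product {..<m} (G \<circ> e))"
  using assms by (auto simp: hom_def coordinates_def PiE_iff fun_eq_iff)

text \<open>The image of the compact set \<open>X\<close> under a continuous map is compact, hence
  closed in the Hausdorff product.\<close>

lemma coordinates_closed_subgroup:
  assumes G: "\<And>i. i \<in> I \<Longrightarrow> G i \<in> compact_groups"
    and X: "closed_subgroup X (top_product I G)" and e: "\<And>k. k < m \<Longrightarrow> e k \<in> I"
  shows "closed_subgroup (coordinates m e ` X) (top_product {..<m} (G \<circ> e))"
proof -
  let ?P = "top_product I G" and ?Q = "top_product {..<m} (G \<circ> e)"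
  have P: "?P \<in> compact_groups" and Q: "?Q \<in> compact_groups"
    using G e by (auto intro: top_product_compact_groups)
  have h: "group_hom ?P ?Q (coordinates m e)"
    using compact_groups_imp_group[OF P] compact_groups_imp_group[OF Q] coordinates_hom[of m e I G] e
    by (simp add: group_hom_def group_hom_axioms_def)
  have "continuous_map (topol ?P) (topol ?Q) (coordinates m e)"
    using e by (auto simp: continuous_map_componentwise coordinates_def
        intro: continuous_map_product_projection)
  moreover have "compactin (topol ?P) X"
    using P X by (auto simp: compact_groups_def closed_subgroup_def intro: closedin_compact_space)
  ultimately have "compactin (topol ?Q) (coordinates m e ` X)"
    by (rule image_compactin[rotated])
  then have "closedin (topol ?Q) (coordinates m e ` X)"
    using Q by (intro compactin_imp_closedin) (auto simp: compact_groups_def)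
  moreover have "subgroup (coordinates m e ` X) ?Q"
    using X group_hom.subgroup_img_is_subgroup[OF h] by (simp add: closed_subgroup_def)
  ultimately show ?thesis
    by (simp add: closed_subgroup_def)
qed

section \<open>Approximation of quotients\<close>

text \<open>The hypothesis on \<open>K\<close> isolates what the argument asks of a class: copies of
  closed subgroups of finite products of the given groups. Abstract isomorphism suffices because an
  approximating map has no topological requirement, and \<open>K\<close> may live over another type
  than the \<open>G i\<close>.\<close>

lemma approximable_quotient:
  fixes G :: "'i \<Rightarrow> 'a top_group" and K :: "'b top_group set"
  assumes G: "\<And>i. i \<in> I \<Longrightarrow> G i \<in> compact_groups"
    and X: "closed_subgroup X (top_product I G)"
    and N: "N \<lhd> top_subgroup (top_product I G) X"
    and K: "\<And>m F S. (\<And>k. k < m \<Longrightarrow> F k \<in> G ` I) \<Longrightarrow> closed_subgroup S (top_product {..<m::nat} F) \<Longrightarrow>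
      \<exists>H\<in>K. group H \<and> (\<exists>f. f \<in> iso (top_subgroup (top_product {..<m} F) S) H)"
  shows "approximable K (top_subgroup (top_product I G) X Mod N)"
  unfolding approximable_def
proof (intro allI impI, elim conjE)
  define P where "P = top_product I G"
  define XG where "XG = top_subgroup P X"
  let ?Q = "XG Mod N"
  fix \<Phi> n
  assume fin: "finite \<Phi>" and "\<Phi> \<subseteq> carrier (top_subgroup (top_product I G) X Mod N)"
  then have \<Phi>: "\<Phi> \<subseteq> carrier ?Q"
    by (simp add: P_def XG_def)
  have P: "P \<in> compact_groups"
    unfolding P_def using G by (rule top_product_compact_groups)
  have XP: "closed_subgroup X P"
    using X by (simp add: P_def)
  have XGc: "XG \<in> compact_groups"
    unfolding XG_def using P XP by (rule top_subgroup_compact_groups)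
  have cX: "carrier XG = X"
    by (simp add: XG_def)
  interpret N: normal N XG
    using N by (simp add: XG_def P_def)
  interpret Q: group ?Q
    by (rule N.factorgroup_is_group)
  interpret p: group_hom XG ?Q "\<lambda>x. N #>\<^bsub>XG\<^esub> x"
    by unfold_locales (rule N.r_coset_hom_Mod)
  \<comment> \<open>The trivial coset is represented by the unit, so that the approximating map will
    send 1 to 1.\<close>
  have "\<exists>r. \<forall>c \<in> carrier ?Q. r c \<in> X \<and> N #>\<^bsub>XG\<^esub> (r c) = c \<and> (c = N \<longrightarrow> r c = \<one>\<^bsub>XG\<^esub>)"
  proof (intro bchoice ballI)
    fix c assume "c \<in> carrier ?Q"
    then obtain x where "x \<in> X" "N #>\<^bsub>XG\<^esub> x = c"
      by (auto simp: FactGroup_def RCOSETS_def cX)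
    moreover have "N #>\<^bsub>XG\<^esub> \<one>\<^bsub>XG\<^esub> = N"
      using p.hom_one by (simp add: FactGroup_def)
    moreover have "\<one>\<^bsub>XG\<^esub> \<in> X"
      using N.one_closed cX by blast
    ultimately show "\<exists>x. x \<in> X \<and> N #>\<^bsub>XG\<^esub> x = c \<and> (c = N \<longrightarrow> x = \<one>\<^bsub>XG\<^esub>)"
      by (cases "c = N") auto
  qed
  then obtain r where
    "\<forall>c \<in> carrier ?Q. r c \<in> X \<and> N #>\<^bsub>XG\<^esub> (r c) = c \<and> (c = N \<longrightarrow> r c = \<one>\<^bsub>XG\<^esub>)" ..
  then have r: "\<And>c. c \<in> carrier ?Q \<Longrightarrow> r c \<in> X"
    "\<And>c. c \<in> carrier ?Q \<Longrightarrow> N #>\<^bsub>XG\<^esub> (r c) = c" "N \<in> carrier ?Q \<Longrightarrow> r N = \<one>\<^bsub>XG\<^esub>"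
    by simp_all
  have oneQ: "\<one>\<^bsub>?Q\<^esub> = N"
    by (simp add: FactGroup_def)
  define E where "E = {r g \<otimes>\<^bsub>XG\<^esub> r h \<otimes>\<^bsub>XG\<^esub> inv\<^bsub>XG\<^esub> (r (g \<otimes>\<^bsub>?Q\<^esub> h)) | g h.
    g \<in> \<Phi> \<and> h \<in> \<Phi> \<and> g \<otimes>\<^bsub>?Q\<^esub> h \<in> \<Phi>}"
  have "E \<subseteq> (\<lambda>(g, h). r g \<otimes>\<^bsub>XG\<^esub> r h \<otimes>\<^bsub>XG\<^esub> inv\<^bsub>XG\<^esub> (r (g \<otimes>\<^bsub>?Q\<^esub> h))) ` (\<Phi> \<times> \<Phi>)"
    by (auto simp: E_def)
  then have finE: "finite E"
    by (rule finite_subset) (simp add: fin)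
  have EN: "E \<subseteq> N"
  proof
    fix x assume "x \<in> E"
    then obtain g h where gh: "g \<in> \<Phi>" "h \<in> \<Phi>" "g \<otimes>\<^bsub>?Q\<^esub> h \<in> \<Phi>"
      and x: "x = r g \<otimes>\<^bsub>XG\<^esub> r h \<otimes>\<^bsub>XG\<^esub> inv\<^bsub>XG\<^esub> (r (g \<otimes>\<^bsub>?Q\<^esub> h))"
      by (auto simp: E_def)
    have gh': "g \<in> carrier ?Q" "h \<in> carrier ?Q" "g \<otimes>\<^bsub>?Q\<^esub> h \<in> carrier ?Q"
      using gh \<Phi> by auto
    have rc: "r g \<in> carrier XG" "r h \<in> carrier XG" "r (g \<otimes>\<^bsub>?Q\<^esub> h) \<in> carrier XG"
      using r(1) gh' by (simp_all add: cX)
    \<comment> \<open>The quotient map is a homomorphism sending each representative to its coset,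
      so the defect becomes trivial in the quotient.\<close>
    have "N #>\<^bsub>XG\<^esub> x = g \<otimes>\<^bsub>?Q\<^esub> h \<otimes>\<^bsub>?Q\<^esub> inv\<^bsub>?Q\<^esub> (g \<otimes>\<^bsub>?Q\<^esub> h)"
      unfolding x using rc r(2) gh' by (simp del: mult_FactGroup)
    also have "\<dots> = N"
      using gh' by (metis Q.r_inv oneQ)
    finally show "x \<in> N"
      using N.coset_join1[OF _ _ N.subgroup_axioms] rc x by auto
  qed
  define C where "C = conj_products n E XG"
  have CN: "C \<subseteq> N"
    unfolding C_def using N.normal_axioms EN by (rule N.conj_products_subset_normal)
  have EX: "E \<subseteq> carrier XG" and CX: "C \<subseteq> X"
    using EN CN N.subset cX by auto
  \<comment> \<open>Compact in a Hausdorff group means closed in \<open>XG\<close>; as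
    \<open>X\<close> is closed in the product, \<open>C\<close> is closed there too.\<close>
  have "closedin (topol XG) C"
    using compactin_conj_products[OF XGc finE EX] XGc
    by (auto simp: C_def compact_groups_def intro: compactin_imp_closedin)
  then have "closedin (topol P) C"
    using XP by (auto simp: XG_def closed_subgroup_def closedin_closed_subtopology)
  then have clC: "closedin (product_topology (\<lambda>i. topol (G i)) I) C"
    by (simp add: P_def)
  have "\<exists>J. finite J \<and> J \<subseteq> I \<and> (\<forall>c\<in>C. \<exists>j\<in>J. c j \<noteq> r g j)" if g: "g \<in> \<Phi> - {N}" for g
  proof -
    have gQ: "g \<in> carrier ?Q"
      using g \<Phi> by auto
    \<comment> \<open>A representative in \<open>N\<close> would give the trivial coset, whereas
      \<open>g\<close> differs from \<open>N\<close>.\<close>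
    have "r g \<notin> N"
      using r(1,2)[OF gQ] g N.coset_join2[OF _ N.subgroup_axioms] by (auto simp: cX)
    then have "r g \<notin> C"
      using CN by blast
    moreover have "X \<subseteq> topspace (product_topology (\<lambda>i. topol (G i)) I)"
      using XP by (intro closedin_subset) (simp add: closed_subgroup_def P_def)
    then have "r g \<in> topspace (product_topology (\<lambda>i. topol (G i)) I)"
      using r(1)[OF gQ] by blast
    ultimately show ?thesis
      using separating_coordinates[OF clC] by metis
  qed
  then obtain J where J: "\<And>g. g \<in> \<Phi> - {N} \<Longrightarrow> finite (J g)" "\<And>g. g \<in> \<Phi> - {N} \<Longrightarrow> J g \<subseteq> I"
    "\<And>g c. g \<in> \<Phi> - {N} \<Longrightarrow> c \<in> C \<Longrightarrow> \<exists>j\<in>J g. c j \<noteq> r g j"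
    by metis
  \<comment> \<open>Finitely many elements of \<open>\<Phi>\<close> each contribute a finite set of
    coordinates; the union handles all of them with one projection.\<close>
  define J' where "J' = (\<Union>g\<in>\<Phi> - {N}. J g)"
  have "finite J'"
    using fin J(1) by (auto simp: J'_def)
  then obtain e m where e: "J' = e ` {..<m::nat}"
    by (metis finite_imp_nat_seg_image_inj_on lessThan_def)
  have eI: "e k \<in> I" if "k < m" for k
    using that e J(2) by (auto simp: J'_def)
  let ?F = "G \<circ> e" and ?c = "coordinates m e"
  let ?S = "top_subgroup (top_product {..<m} ?F) (?c ` X)"
  \<comment> \<open>The class need not contain the projection of \<open>X\<close> itself, only the
    copy \<open>H\<close> of it.\<close>
  obtain H f where H: "H \<in> K" "group H" and f: "f \<in> iso ?S H"
    using K[of m ?F "?c ` X"] coordinates_closed_subgroup[OF G X eI] eI by auto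
  have "?c \<in> hom P (top_product {..<m} ?F)" "X \<subseteq> carrier P"
    using coordinates_hom[of m e I G] eI closed_subgroup_subset[OF XP] by (simp_all add: P_def)
  then have "?c \<in> hom XG ?S"
    by (auto simp: hom_def XG_def subset_iff simp del: top_product_simps)
  moreover have "f \<in> hom ?S H" and fbij: "bij_betw f (?c ` X) (carrier H)"
    using f by (auto simp: iso_def)
  ultimately have "f \<circ> ?c \<in> hom XG H"
    by (auto intro: hom_compose)
  define \<psi> where "\<psi> = f \<circ> ?c"
  interpret \<psi>: group_hom XG H \<psi>
    using \<open>f \<circ> ?c \<in> hom XG H\<close> H(2)
    by (simp add: \<psi>_def group_hom_def group_hom_axioms_def N.is_group)
  have surj: "\<psi> ` carrier XG = carrier H"
    using fbij by (auto simp: \<psi>_def cX bij_betw_def image_comp)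
  \<comment> \<open>Since \<open>f\<close> is injective on the projected subgroup, equal values of
    \<open>\<psi>\<close> mean equal coordinates at every \<open>e k\<close>, that is, on all of
    \<open>J'\<close>.\<close>
  have agree: "x j = y j" if "\<psi> x = \<psi> y" "x \<in> X" "y \<in> X" "j \<in> J'" for x y j
  proof -
    have "?c x = ?c y"
      using that(1-3) fbij by (auto simp: \<psi>_def bij_betw_def dest: inj_onD)
    then show ?thesis
      using that(4) unfolding e coordinates_def by (auto dest: fun_cong simp: restrict_def) (metis lessThan_iff)
  qed
  \<comment> \<open>As \<open>\<psi>\<close> is a homomorphism on \<open>XG\<close>, the defects of
    \<open>\<psi> \<circ> r\<close> are exactly the images of the defects of
    \<open>r\<close>.\<close>
  have defect: "{(\<psi> \<circ> r) g \<otimes>\<^bsub>H\<^esub> (\<psi> \<circ> r) h \<otimes>\<^bsub>H\<^esub> inv\<^bsub>H\<^esub> ((\<psi> \<circ> r) (g \<otimes>\<^bsub>?Q\<^esub> h)) | g h.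
      g \<in> \<Phi> \<and> h \<in> \<Phi> \<and> g \<otimes>\<^bsub>?Q\<^esub> h \<in> \<Phi>} = \<psi> ` E" (is "?D = _")
  proof -
    have *: "(\<psi> \<circ> r) g \<otimes>\<^bsub>H\<^esub> (\<psi> \<circ> r) h \<otimes>\<^bsub>H\<^esub> inv\<^bsub>H\<^esub> ((\<psi> \<circ> r) (g \<otimes>\<^bsub>?Q\<^esub> h)) =
        \<psi> (r g \<otimes>\<^bsub>XG\<^esub> r h \<otimes>\<^bsub>XG\<^esub> inv\<^bsub>XG\<^esub> (r (g \<otimes>\<^bsub>?Q\<^esub> h)))"
      if "g \<in> \<Phi>" "h \<in> \<Phi>" "g \<otimes>\<^bsub>?Q\<^esub> h \<in> \<Phi>" for g h
    proof -
      have "r g \<in> carrier XG" "r h \<in> carrier XG" "r (g \<otimes>\<^bsub>?Q\<^esub> h) \<in> carrier XG"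
        using that \<Phi> r(1) unfolding cX by blast+
      then show ?thesis
        by simp
    qed
    show ?thesis
    proof (intro equalityI subsetI)
      fix z assume "z \<in> ?D"
      then show "z \<in> \<psi> ` E"
        using * unfolding E_def by blast
    next
      fix z assume "z \<in> \<psi> ` E"
      then obtain g h where "g \<in> \<Phi>" "h \<in> \<Phi>" "g \<otimes>\<^bsub>?Q\<^esub> h \<in> \<Phi>"
        "z = \<psi> (r g \<otimes>\<^bsub>XG\<^esub> r h \<otimes>\<^bsub>XG\<^esub> inv\<^bsub>XG\<^esub> (r (g \<otimes>\<^bsub>?Q\<^esub> h)))"
        unfolding E_def by blast
      then show "z \<in> ?D"
        using * by (metis (mono_tags, lifting) mem_Collect_eq)
    qed
  qed
  have "separated n ((\<psi> \<circ> r) ` (\<Phi> - {N})) (\<psi> ` E) H"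
    unfolding separated_def
  proof (rule ccontr)
    assume "(\<psi> \<circ> r) ` (\<Phi> - {N}) \<inter> conj_products n (\<psi> ` E) H \<noteq> {}"
    then obtain g where g: "g \<in> \<Phi> - {N}" "\<psi> (r g) \<in> conj_products n (\<psi> ` E) H"
      by auto
    \<comment> \<open>A violation of separation lifts to a point of \<open>C\<close> with the same
      image as \<open>r g\<close>. The two then agree on \<open>J g\<close>, against the choice of
      these coordinates.\<close>
    then obtain c where c: "c \<in> C" "\<psi> (r g) = \<psi> c"
      using \<psi>.conj_products_image[OF surj EX] unfolding C_def by blast
    have "r g \<in> X"
      using g \<Phi> r(1) by blast
    then have "c j = r g j" if "j \<in> J g" for j
      using agree[of c "r g" j] c CX g that by (auto simp: J'_def)
    then show False
      using J(3)[OF g(1) c(1)] by blast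
  qed
  moreover have "\<psi> \<circ> r \<in> \<Phi> \<rightarrow> carrier H"
    using \<Phi> r(1) surj by (auto simp: cX)
  moreover have "N \<in> \<Phi> \<longrightarrow> (\<psi> \<circ> r) N = \<one>\<^bsub>H\<^esub>"
    using \<Phi> r(3) by auto
  ultimately show "\<exists>H\<in>K. \<exists>\<phi>\<in>\<Phi> \<rightarrow> carrier H.
      (\<one>\<^bsub>top_subgroup (top_product I G) X Mod N\<^esub> \<in> \<Phi> \<longrightarrow>
         \<phi> \<one>\<^bsub>top_subgroup (top_product I G) X Mod N\<^esub> = \<one>\<^bsub>H\<^esub>) \<and>
      separated n (\<phi> ` (\<Phi> - {\<one>\<^bsub>top_subgroup (top_product I G) X Mod N\<^esub>}))
        {\<phi> g \<otimes>\<^bsub>H\<^esub> \<phi> h \<otimes>\<^bsub>H\<^esub> inv\<^bsub>H\<^esub> (\<phi> (g \<otimes>\<^bsub>top_subgroup (top_product I G) X Mod N\<^esub> h)) | g h.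
          g \<in> \<Phi> \<and> h \<in> \<Phi> \<and> g \<otimes>\<^bsub>top_subgroup (top_product I G) X Mod N\<^esub> h \<in> \<Phi>} H"
    unfolding P_def[symmetric] XG_def[symmetric] oneQ
    by (intro bexI[OF _ H(1)] bexI[of _ "\<psi> \<circ> r"] conjI) (simp_all only: defect)
qed

section \<open>Nilpotent and solvable groups\<close>

lemma (in group) lower_central_subset: "lower_central G n \<subseteq> carrier G"
proof (induction n)
  case (Suc n)
  then show ?case
    by (auto intro!: generate_incl)
qed simp

lemma (in group) one_in_lower_central: "\<one> \<in> lower_central G n"
  by (cases n) (auto intro: generate.one)

lemma (in group) lower_central_trivial_mono:
  assumes "lower_central G m = {\<one>}" "m \<le> n"
  shows "lower_central G n = {\<one>}"
  using assms(2)
proof (induction rule: dec_induct)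
  case (step n)
  \<comment> \<open>Once a term is trivial, the next one is generated by commutators with the
    unit.\<close>
  have "{x \<otimes> y \<otimes> inv x \<otimes> inv y | x y. x \<in> {\<one>} \<and> y \<in> carrier G} = {\<one>}"
    by force
  with step.IH show ?case
    by (simp add: generate_one)
qed (use assms(1) in simp)

lemma (in group_hom) lower_central_image: "h ` lower_central G n \<subseteq> lower_central H n"
proof (induction n)
  case (Suc n)
  let ?A = "{x \<otimes> y \<otimes> inv x \<otimes> inv y | x y. x \<in> lower_central G n \<and> y \<in> carrier G}"
  let ?B = "{x \<otimes>\<^bsub>H\<^esub> y \<otimes>\<^bsub>H\<^esub> inv\<^bsub>H\<^esub> x \<otimes>\<^bsub>H\<^esub> inv\<^bsub>H\<^esub> y | x y. x \<in> lower_central H n \<and> y \<in> carrier H}"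
  have L: "lower_central G n \<subseteq> carrier G"
    by (rule G.lower_central_subset)
  then have A: "?A \<subseteq> carrier G"
    by auto
  have "h ` ?A \<subseteq> ?B"
  proof
    fix z assume "z \<in> h ` ?A"
    then obtain x y where xy: "x \<in> lower_central G n" "y \<in> carrier G"
      and z: "z = h (x \<otimes> y \<otimes> inv x \<otimes> inv y)"
      by blast
    have "x \<in> carrier G" "h x \<in> lower_central H n" "h y \<in> carrier H"
      using xy L Suc by auto
    moreover from this have "z = h x \<otimes>\<^bsub>H\<^esub> h y \<otimes>\<^bsub>H\<^esub> inv\<^bsub>H\<^esub> h x \<otimes>\<^bsub>H\<^esub> inv\<^bsub>H\<^esub> h y"
      using xy z by simp
    ultimately show "z \<in> ?B"
      by blast
  qed
  then have "generate H (h ` ?A) \<subseteq> generate H ?B"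
    by (rule H.mono_generate)
  then show ?case
    using generate_img[OF A] by simp
qed auto

text \<open>The maps \<open>p j\<close> have trivial common kernel, so the group embeds in a finite
  product of nilpotent groups. Working with the maps avoids computing the lower central series of a
  product or a subgroup.\<close>

lemma nilpotent_if_separating_homs:
  fixes G (structure)
  assumes "group G" "finite J"
    and p: "\<And>j. j \<in> J \<Longrightarrow> group_hom G (F j) (p j)"
    and sep: "\<And>x. x \<in> carrier G \<Longrightarrow> (\<And>j. j \<in> J \<Longrightarrow> p j x = \<one>\<^bsub>F j\<^esub>) \<Longrightarrow> x = \<one>"
    and nil: "\<And>j. j \<in> J \<Longrightarrow> nilpotent (F j)"
  shows "nilpotent G"
proof -
  interpret group G by fact
  have "\<forall>j\<in>J. \<exists>n. lower_central (F j) n = {\<one>\<^bsub>F j\<^esub>}"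
    using nil by (simp add: nilpotent_def)
  then obtain n where n: "\<And>j. j \<in> J \<Longrightarrow> lower_central (F j) (n j) = {\<one>\<^bsub>F j\<^esub>}"
    by metis
  \<comment> \<open>\<open>sum n J\<close> dominates every \<open>n j\<close> and is thus one index
    for all factors; for empty \<open>J\<close> it is 0, and \<open>sep\<close> alone makes the
    group trivial.\<close>
  have triv: "lower_central (F j) (sum n J) = {\<one>\<^bsub>F j\<^esub>}" if "j \<in> J" for j
    using group.lower_central_trivial_mono[OF _ n[OF that]] p[OF that] assms(2) that
    by (auto simp: group_hom_def intro: member_le_sum)
  have "x = \<one>" if x: "x \<in> lower_central G (sum n J)" for x
  proof (rule sep)
    show "x \<in> carrier G"
      using x lower_central_subset by blast
    show "p j x = \<one>\<^bsub>F j\<^esub>" if "j \<in> J" for j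
      using group_hom.lower_central_image[OF p[OF that]] triv[OF that] x by blast
  qed
  then have "lower_central G (sum n J) = {\<one>}"
    using one_in_lower_central by blast
  then show ?thesis
    by (auto simp: nilpotent_def)
qed

lemma (in group) derived_trivial_mono:
  assumes "(derived G ^^ m) (carrier G) = {\<one>}" "m \<le> n"
  shows "(derived G ^^ n) (carrier G) = {\<one>}"
  using assms(2)
proof (induction rule: dec_induct)
  case (step n)
  have "derived G {\<one>} = {\<one>}"
    by (simp add: derived_def generate_one)
  then show ?case
    using step by simp
qed (use assms(1) in simp)

text \<open>The same embedding argument with the derived series, using that solvability means that
  this series reaches the trivial group.\<close>

lemma solvable_if_separating_homs:
  fixes G (structure)
  assumes "group G" "finite J"
    and p: "\<And>j. j \<in> J \<Longrightarrow> group_hom G (F j) (p j)"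
    and sep: "\<And>x. x \<in> carrier G \<Longrightarrow> (\<And>j. j \<in> J \<Longrightarrow> p j x = \<one>\<^bsub>F j\<^esub>) \<Longrightarrow> x = \<one>"
    and solv: "\<And>j. j \<in> J \<Longrightarrow> solvable (F j)"
  shows "solvable G"
proof -
  interpret group G by fact
  have grp: "group (F j)" if "j \<in> J" for j
    using p[OF that] by (simp add: group_hom_def)
  have "\<forall>j\<in>J. \<exists>n. (derived (F j) ^^ n) (carrier (F j)) = {\<one>\<^bsub>F j\<^esub>}"
    using solv grp group.solvable_iff_trivial_derived_seq by blast
  then obtain n where n: "\<And>j. j \<in> J \<Longrightarrow> (derived (F j) ^^ n j) (carrier (F j)) = {\<one>\<^bsub>F j\<^esub>}"
    by metis
  let ?D = "(derived G ^^ sum n J) (carrier G)"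
  have triv: "(derived (F j) ^^ sum n J) (carrier (F j)) = {\<one>\<^bsub>F j\<^esub>}" if "j \<in> J" for j
    using group.derived_trivial_mono[OF grp n] assms(2) that
    by (auto intro: member_le_sum)
  have "x = \<one>" if x: "x \<in> ?D" for x
  proof (rule sep)
    show "x \<in> carrier G"
      using x exp_of_derived_in_carrier by blast
    show "p j x = \<one>\<^bsub>F j\<^esub>" if j: "j \<in> J" for j
    proof -
      interpret p: group_hom G "F j" "p j"
        using p[OF j] .
      \<comment> \<open>A homomorphism maps the derived series onto that of its image, and
        monotonicity compares the latter with the series of \<open>F j\<close>.\<close>
      have "p j ` ?D = (derived (F j) ^^ sum n J) (p j ` carrier G)"
        by (simp add: p.exp_of_derived_img)
      also have "\<dots> \<subseteq> (derived (F j) ^^ sum n J) (carrier (F j))"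
        by (intro p.H.mono_exp_of_derived) auto
      finally show ?thesis
        using triv[OF j] x by blast
    qed
  qed
  moreover have "\<one> \<in> ?D"
    using exp_of_derived_is_subgroup[OF subgroup_self] by (rule subgroup.one_closed)
  ultimately have "?D = {\<one>}"
    by blast
  then show ?thesis
    using solvable_iff_trivial_derived_seq by blast
qed

section \<open>Membership in the classes\<close>

text \<open>A finite carrier injects into the naturals, which gives the copy. The maps
  \<open>p k\<close> are the coordinate projections transported to it; they supply the separating
  homomorphisms for nilpotency and solvability.\<close>

lemma finite_copy_of_subgroup_of_product:
  fixes F :: "nat \<Rightarrow> 'a top_group"
  assumes F: "\<And>k. k < m \<Longrightarrow> F k \<in> finite_groups"
    and S: "closed_subgroup S (top_product {..<m} F)"
  obtains H :: "nat top_group" and f p where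
    "H \<in> finite_groups" "f \<in> iso (top_subgroup (top_product {..<m} F) S) H"
    "\<And>k. k \<in> {..<m} \<Longrightarrow> group_hom H (F k) (p k)"
    "\<And>x. x \<in> carrier H \<Longrightarrow> (\<And>k. k \<in> {..<m} \<Longrightarrow> p k x = \<one>\<^bsub>F k\<^esub>) \<Longrightarrow> x = \<one>\<^bsub>H\<^esub>"
proof -
  let ?P = "top_product {..<m} F" and ?T = "top_subgroup (top_product {..<m} F) S"
  have P: "?P \<in> compact_groups"
    using F finite_groups_subset_compact_groups by (intro top_product_compact_groups) auto
  have T: "?T \<in> compact_groups"
    using P S by (rule top_subgroup_compact_groups)
  have SP: "S \<subseteq> carrier ?P"
    using S by (rule closed_subgroup_subset)
  have "finite (carrier ?P)"
    using F by (auto simp: finite_groups_def intro!: finite_PiE)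
  then have fin: "finite S"
    using SP finite_subset by blast
  then obtain f :: "(nat \<Rightarrow> 'a) \<Rightarrow> nat" where f: "inj_on f S"
    using finite_imp_inj_to_nat_seg by blast
  let ?H = "copy_group f ?T"
  have grpT: "group ?T"
    using T by (rule compact_groups_imp_group)
  have iso: "f \<in> iso ?T ?H" and grpH: "group ?H"
    using copy_group_iso[OF grpT] f by auto
  have "?H \<in> compact_groups"
    using T f by (intro copy_group_compact_groups) auto
  then have H: "?H \<in> finite_groups"
    using fin by (intro finite_compact_group) (auto simp: copy_group_def)
  let ?g = "inv_into S f"
  have isog: "?g \<in> iso ?H ?T"
    using group.iso_set_sym[OF grpT iso] by simp
  interpret g: group_hom ?H ?T ?g
    using isog grpH grpT by (simp add: group_hom_def group_hom_axioms_def iso_def)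
  show thesis
  proof (rule that[OF H iso])
    fix k assume k: "k \<in> {..<m}"
    have "(\<lambda>x. x k) \<in> hom ?T (F k)"
      using SP k by (auto simp: hom_def)
    then have "(\<lambda>x. x k) \<circ> ?g \<in> hom ?H (F k)"
      by (intro hom_compose[OF g.homh])
    then show "group_hom ?H (F k) (\<lambda>x. ?g x k)"
      using grpH F k by (simp add: group_hom_def group_hom_axioms_def finite_groups_def o_def)
  next
    fix x assume x: "x \<in> carrier ?H" and triv: "\<And>k. k \<in> {..<m} \<Longrightarrow> ?g x k = \<one>\<^bsub>F k\<^esub>"
    have "?g x \<in> (\<Pi>\<^sub>E i\<in>{..<m}. carrier (F i))"
      using g.hom_closed[OF x] SP by auto
    \<comment> \<open>Trivial coordinates determine the element, because members of the product are
      extensional functions.\<close>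
    then have "?g x = \<one>\<^bsub>?T\<^esub>"
      using triv by (auto simp: fun_eq_iff PiE_iff extensional_def)
    then show "x = \<one>\<^bsub>?H\<^esub>"
      using isog x g.iso_iff by blast
  qed
qed

text \<open>An infinite set is equinumerous with its square, so coordinates can be absorbed one by
  one by a pairing function. The summand \<open>nat\<close> makes the target infinite even when
  \<open>'a\<close> is finite.\<close>

lemma finite_product_embeds:
  "\<exists>f :: (nat \<Rightarrow> 'a) \<Rightarrow> 'a + nat. inj_on f (\<Pi>\<^sub>E k\<in>{..<m}. A k)"
proof (induction m)
  case 0
  then show ?case
    by simp
next
  case (Suc m)
  then obtain f :: "(nat \<Rightarrow> 'a) \<Rightarrow> 'a + nat" where f: "inj_on f (\<Pi>\<^sub>E k\<in>{..<m}. A k)"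
    by blast
  have "infinite (UNIV :: ('a + nat) set)"
    by (simp add: finite_Plus_UNIV_iff)
  then obtain q :: "('a + nat) \<times> ('a + nat) \<Rightarrow> 'a + nat" where "bij_betw q (UNIV \<times> UNIV) UNIV"
    using card_of_Times_same_infinite card_of_ordIso by blast
  then have q: "inj q"
    by (simp add: bij_betw_def)
  \<comment> \<open>The pairing function \<open>q\<close> combines the new last coordinate, embedded
    by \<open>Inl\<close>, with the code of the first \<open>m\<close> coordinates.\<close>
  have "inj_on (\<lambda>x. q (Inl (x m), f (restrict x {..<m}))) (\<Pi>\<^sub>E k\<in>{..<Suc m}. A k)"
  proof (rule inj_onI)
    fix x y
    assume x: "x \<in> (\<Pi>\<^sub>E k\<in>{..<Suc m}. A k)" and y: "y \<in> (\<Pi>\<^sub>E k\<in>{..<Suc m}. A k)"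
      and "q (Inl (x m), f (restrict x {..<m})) = q (Inl (y m), f (restrict y {..<m}))"
    then have *: "x m = y m" "f (restrict x {..<m}) = f (restrict y {..<m})"
      using injD[OF q] by blast+
    have rest: "restrict z {..<m} \<in> (\<Pi>\<^sub>E k\<in>{..<m}. A k)" if "z \<in> (\<Pi>\<^sub>E k\<in>{..<Suc m}. A k)" for z
      using that by (auto simp only: PiE_iff restrict_extensional restrict_apply' lessThan_iff less_Suc_eq)
    from *(2) rest[OF x] rest[OF y] have r: "restrict x {..<m} = restrict y {..<m}"
      by (rule inj_onD[OF f])
    have "x k = y k" if "k < m" for k
      using fun_cong[OF r, of k] that by simp
    with *(1) have "x k = y k" if "k \<in> {..<Suc m}" for k
      using that by (auto simp: less_Suc_eq)
    then show "x = y"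
      by (rule PiE_ext[OF x y])
  qed
  then show ?case
    by blast
qed

text \<open>Both closure properties hold only up to isomorphism, so they are chained: the product
  has a copy \<open>H1\<close> in \<open>K\<close>, the image of \<open>S\<close> is a closed
  subgroup of \<open>H1\<close>, and that subgroup has a copy in \<open>K\<close>.\<close>

lemma closed_class_contains_subgroup_of_product:
  assumes K: "K \<subseteq> compact_groups" "closed_under_closed_subgroups K" "closed_under_finite_products K"
    and F: "\<And>k. k < m \<Longrightarrow> F k \<in> K"
    and S: "closed_subgroup S (top_product {..<m::nat} F)"
  shows "\<exists>H\<in>K. group H \<and> (\<exists>f. f \<in> iso (top_subgroup (top_product {..<m} F) S) H)"
proof -
  let ?P = "top_product {..<m} F"
  have P: "group ?P"
    using F K(1) by (intro group_top_product compact_groups_imp_group) auto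
  have "\<exists>H1\<in>K. top_isomorphic ?P H1"
    using K(3)[unfolded closed_under_finite_products_def, rule_format, of m F] F by blast
  then obtain H1 h where H1: "H1 \<in> K" and h: "h \<in> iso ?P H1" and hh: "homeomorphic_map (topol ?P) (topol H1) h"
    unfolding top_isomorphic_def by blast
  have grp1: "group H1"
    using H1 K(1) by (auto intro: compact_groups_imp_group)
  interpret h: group_hom ?P H1 h
    using h P grp1 by (simp add: group_hom_def group_hom_axioms_def iso_def)
  have sub: "subgroup S ?P" and cl: "closedin (topol ?P) S"
    using S by (auto simp: closed_subgroup_def)
  have SP: "S \<subseteq> carrier ?P"
    using sub by (rule subgroup.subset)
  have subh: "subgroup (h ` S) H1"
    using sub by (rule h.subgroup_img_is_subgroup)
  \<comment> \<open>This step uses that the isomorphism onto \<open>H1\<close> is a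
    homeomorphism.\<close>
  moreover have "closedin (topol H1) (h ` S)"
    using hh cl closedin_subset[OF cl] homeomorphic_map_closedness_eq by blast
  ultimately have "closed_subgroup (h ` S) H1"
    by (simp add: closed_subgroup_def)
  then obtain H where H: "H \<in> K" and "top_isomorphic (top_subgroup H1 (h ` S)) H"
    using K(2) H1 unfolding closed_under_closed_subgroups_def by blast
  then obtain g where g: "g \<in> iso (top_subgroup H1 (h ` S)) H"
    unfolding top_isomorphic_def by blast
  have "inj_on h (carrier ?P)"
    using h by (simp add: iso_def bij_betw_def)
  then have "inj_on h S"
    using SP by (rule inj_on_subset)
  moreover have "h \<in> hom (top_subgroup ?P S) (top_subgroup H1 (h ` S))"
    using subsetD[OF SP] by (intro homI) (simp_all del: top_product_simps)
  ultimately have "h \<in> iso (top_subgroup ?P S) (top_subgroup H1 (h ` S))"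
    by (simp add: iso_def bij_betw_def)
  then have "g \<circ> h \<in> iso (top_subgroup ?P S) H"
    using g by (rule iso_set_trans)
  then show ?thesis
    using H K(1) compact_groups_imp_group by blast
qed

section \<open>Approximability for closed classes and for the four concrete classes\<close>

theorem corollary6:
  fixes G :: "'i \<Rightarrow> 'a top_group"
    and I :: "'i set"
    and X N :: "('i \<Rightarrow> 'a) set"
  assumes "closed_subgroup X (top_product I G)"
    and "N \<lhd> top_subgroup (top_product I G) X"
  shows
    "(\<forall>K :: 'a top_group set.
        K \<subseteq> compact_groups \<and>
        closed_under_closed_subgroups K \<and>
        closed_under_finite_products K \<and>
        (\<forall>i\<in>I. G i \<in> K) \<longrightarrow>
        approximable K (top_subgroup (top_product I G) X Mod N)) \<and>
     ((\<forall>i\<in>I. G i \<in> finite_nilpotent_groups) \<longrightarrow>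
        approximable (finite_nilpotent_groups :: nat top_group set)
          (top_subgroup (top_product I G) X Mod N)) \<and>
     ((\<forall>i\<in>I. G i \<in> finite_solvable_groups) \<longrightarrow>
        approximable (finite_solvable_groups :: nat top_group set)
          (top_subgroup (top_product I G) X Mod N)) \<and>
     ((\<forall>i\<in>I. G i \<in> finite_groups) \<longrightarrow>
        approximable (finite_groups :: nat top_group set)
          (top_subgroup (top_product I G) X Mod N)) \<and>
     ((\<forall>i\<in>I. G i \<in> compact_groups) \<longrightarrow>
        approximable (compact_groups :: ('a + nat) top_group set)
          (top_subgroup (top_product I G) X Mod N))"
proof (intro conjI allI impI)
  \<comment> \<open>Each of the five claims is an instance of \<open>approximable_quotient\<close>;
    it remains to find, in the respective class, a copy of a closed subgroup of a finite
    product.\<close>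
  fix K :: "'a top_group set"
  assume K: "K \<subseteq> compact_groups \<and> closed_under_closed_subgroups K \<and>
    closed_under_finite_products K \<and> (\<forall>i\<in>I. G i \<in> K)"
  show "approximable K (top_subgroup (top_product I G) X Mod N)"
  proof (rule approximable_quotient[OF _ assms])
    fix m F S
    assume "\<And>k. k < m \<Longrightarrow> F k \<in> G ` I" and S: "closed_subgroup S (top_product {..<m::nat} F)"
    then have F: "F k \<in> K" if "k < m" for k
      using K that by force
    show "\<exists>H\<in>K. group H \<and> (\<exists>f. f \<in> iso (top_subgroup (top_product {..<m} F) S) H)"
      using K F S by (intro closed_class_contains_subgroup_of_product) auto
  qed (use K in blast)
next
  assume G: "\<forall>i\<in>I. G i \<in> finite_nilpotent_groups"
  show "approximable (finite_nilpotent_groups :: nat top_group set)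
          (top_subgroup (top_product I G) X Mod N)"
  proof (rule approximable_quotient[OF _ assms])
    fix m F S
    assume "\<And>k. k < m \<Longrightarrow> F k \<in> G ` I" and S: "closed_subgroup S (top_product {..<m::nat} F)"
    then have F: "F k \<in> finite_groups" "nilpotent (F k)" if "k < m" for k
      using G that by (force simp: finite_nilpotent_groups_def)+
    obtain H :: "nat top_group" and f p where *:
      "H \<in> finite_groups" "f \<in> iso (top_subgroup (top_product {..<m} F) S) H"
      "\<And>k. k \<in> {..<m} \<Longrightarrow> group_hom H (F k) (p k)"
      "\<And>x. x \<in> carrier H \<Longrightarrow> (\<And>k. k \<in> {..<m} \<Longrightarrow> p k x = \<one>\<^bsub>F k\<^esub>) \<Longrightarrow> x = \<one>\<^bsub>H\<^esub>"
      using finite_copy_of_subgroup_of_product[OF F(1) S] by blast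
    have H: "group H"
      using *(1) by (simp add: finite_groups_def)
    \<comment> \<open>The projections \<open>p k\<close> of the copy are jointly injective with
      nilpotent targets.\<close>
    have "nilpotent H"
      by (rule nilpotent_if_separating_homs[OF H finite_lessThan *(3,4)]) (use F(2) in auto)
    then show "\<exists>H\<in>finite_nilpotent_groups :: nat top_group set.
        group H \<and> (\<exists>f. f \<in> iso (top_subgroup (top_product {..<m} F) S) H)"
      using *(1,2) H by (auto simp: finite_nilpotent_groups_def)
  qed (use G finite_groups_subset_compact_groups in \<open>auto simp: finite_nilpotent_groups_def\<close>)
next
  assume G: "\<forall>i\<in>I. G i \<in> finite_solvable_groups"
  show "approximable (finite_solvable_groups :: nat top_group set)
          (top_subgroup (top_product I G) X Mod N)"
  proof (rule approximable_quotient[OF _ assms])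
    fix m F S
    assume "\<And>k. k < m \<Longrightarrow> F k \<in> G ` I" and S: "closed_subgroup S (top_product {..<m::nat} F)"
    then have F: "F k \<in> finite_groups" "solvable (F k)" if "k < m" for k
      using G that by (force simp: finite_solvable_groups_def)+
    obtain H :: "nat top_group" and f p where *:
      "H \<in> finite_groups" "f \<in> iso (top_subgroup (top_product {..<m} F) S) H"
      "\<And>k. k \<in> {..<m} \<Longrightarrow> group_hom H (F k) (p k)"
      "\<And>x. x \<in> carrier H \<Longrightarrow> (\<And>k. k \<in> {..<m} \<Longrightarrow> p k x = \<one>\<^bsub>F k\<^esub>) \<Longrightarrow> x = \<one>\<^bsub>H\<^esub>"
      using finite_copy_of_subgroup_of_product[OF F(1) S] by blast
    have H: "group H"
      using *(1) by (simp add: finite_groups_def)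
    have "solvable H"
      by (rule solvable_if_separating_homs[OF H finite_lessThan *(3,4)]) (use F(2) in auto)
    then show "\<exists>H\<in>finite_solvable_groups :: nat top_group set.
        group H \<and> (\<exists>f. f \<in> iso (top_subgroup (top_product {..<m} F) S) H)"
      using *(1,2) H by (auto simp: finite_solvable_groups_def)
  qed (use G finite_groups_subset_compact_groups in \<open>auto simp: finite_solvable_groups_def\<close>)
next
  assume G: "\<forall>i\<in>I. G i \<in> finite_groups"
  show "approximable (finite_groups :: nat top_group set)
          (top_subgroup (top_product I G) X Mod N)"
  proof (rule approximable_quotient[OF _ assms])
    fix m F S
    assume "\<And>k. k < m \<Longrightarrow> F k \<in> G ` I" and S: "closed_subgroup S (top_product {..<m::nat} F)"
    then have F: "F k \<in> finite_groups" if "k < m" for k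
      using G that by force
    obtain H :: "nat top_group" and f where
      "H \<in> finite_groups" "f \<in> iso (top_subgroup (top_product {..<m} F) S) H"
      using finite_copy_of_subgroup_of_product[OF F S] by metis
    then show "\<exists>H\<in>finite_groups :: nat top_group set.
        group H \<and> (\<exists>f. f \<in> iso (top_subgroup (top_product {..<m} F) S) H)"
      by (auto simp: finite_groups_def)
  qed (use G finite_groups_subset_compact_groups in auto)
next
  assume G: "\<forall>i\<in>I. G i \<in> compact_groups"
  show "approximable (compact_groups :: ('a + nat) top_group set)
          (top_subgroup (top_product I G) X Mod N)"
  proof (rule approximable_quotient[OF _ assms])
    fix m F S
    assume "\<And>k. k < m \<Longrightarrow> F k \<in> G ` I" and S: "closed_subgroup S (top_product {..<m::nat} F)"
    then have "F k \<in> compact_groups" if "k < m" for k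
      using G that by force
    then have "top_product {..<m} F \<in> compact_groups"
      by (intro top_product_compact_groups) auto
    then have T: "top_subgroup (top_product {..<m} F) S \<in> compact_groups"
      using S by (rule top_subgroup_compact_groups)
    \<comment> \<open>An injection of the whole product restricts to \<open>S\<close>, and copying
      along it yields a compact group over \<open>'a + nat\<close>.\<close>
    obtain f :: "(nat \<Rightarrow> 'a) \<Rightarrow> 'a + nat" where "inj_on f (carrier (top_product {..<m} F))"
      using finite_product_embeds[of m "\<lambda>k. carrier (F k)"] by auto
    moreover have "S \<subseteq> carrier (top_product {..<m} F)"
      using S by (rule closed_subgroup_subset)
    ultimately have f: "inj_on f (carrier (top_subgroup (top_product {..<m} F) S))"
      by (auto intro: inj_on_subset)
    show "\<exists>H\<in>compact_groups :: ('a + nat) top_group set.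
        group H \<and> (\<exists>f. f \<in> iso (top_subgroup (top_product {..<m} F) S) H)"
      using copy_group_compact_groups[OF T f] copy_group_iso[OF compact_groups_imp_group[OF T] f]
      by blast
  qed (use G in auto)
qed

end
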